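(* $$\frac{\sin(6\pi/13)\sin(2\pi/13)\sin(5\pi/13)}{\sin(4\pi/13)\sin(3\pi/13)\sin(\pi/13)}-\frac{\sin(4\pi/13)\sin(3\pi/13)\sin(\pi/13)}{\sin(6\pi/13)\sin(2\pi/13)\sin(5\pi/13)}=3.$$ *)

theory Defs
  imports Complex_Main
begin

end

theory Submission
  imports Defs
begin

text \<open>
  With \<open>x = \<pi>/13\<close>, linearising the two triple products \<open>A\<close> and \<open>B\<close> gives
  \<open>4 A = sin x + sin 3x + sin 4x\<close> and \<open>4 B = sin 2x - sin 5x + sin 6x\<close>.
  Let \<open>P = cos 2x + cos 6x + cos 8x\<close> and \<open>Q = cos 4x + cos 10x + cos 12x\<close> be half the
  quadratic Gaussian periods modulo 13. Then \<open>(4 A)\<^sup>2 = 3/2 + P/2 - Q\<close>,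
  \<open>(4 B)\<^sup>2 = 3/2 + Q/2 - P\<close> and \<open>(4 A) (4 B) = (P - Q)/2\<close>,
  so \<open>A\<^sup>2 - B\<^sup>2 = 3 A B\<close>.
\<close>

text \<open>Product-to-sum twice: first on \<open>sin a * sin b\<close>, then on each resulting
  cosine times \<open>sin c\<close>.\<close>

lemma sin_times_sin_times_sin:
  fixes a b c :: real
  shows "4 * (sin a * sin b * sin c) =
    sin (a + b - c) + sin (a - b + c) + sin (b + c - a) - sin (a + b + c)"
proof -
  have s: "sin a * sin b * sin c = (cos (a - b) * sin c - cos (a + b) * sin c) / 2"
    by (simp add: sin_times_sin algebra_simps)
  have "sin (a - b - c) = - sin (b + c - a)"
    by (simp flip: sin_minus add: algebra_simps)
  then show ?thesis
    unfolding s cos_times_sin by (simp add: field_simps)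
qed

lemma sin_pi_thirteenths_products:
  fixes x :: real
  assumes x: "13 * x = pi"
  defines "A \<equiv> sin (6 * x) * sin (2 * x) * sin (5 * x)"
    and "B \<equiv> sin (4 * x) * sin (3 * x) * sin x"
  shows "A\<^sup>2 - B\<^sup>2 = 3 * (A * B)"
proof -
  \<comment> \<open>As 6 + 2 + 5 = 13, the last term in the expansion of \<open>A\<close>
    vanishes.\<close>
  have sin_refl: "sin (9 * x) = sin (4 * x)" "sin (8 * x) = sin (5 * x)" "sin (13 * x) = 0"
    using sin_pi_minus[of "4 * x"] sin_pi_minus[of "5 * x"] sin_pi
    by (simp_all flip: x del: sin_pi)
  \<comment> \<open>Turning odd multiples into even ones makes every nonconstant cosine below a term
    of \<open>P\<close> or \<open>Q\<close>, up to sign.\<close>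
  have cos_refl: "cos x = - cos (12 * x)" "cos (3 * x) = - cos (10 * x)"
    "cos (5 * x) = - cos (8 * x)" "cos (7 * x) = - cos (6 * x)"
    "cos (9 * x) = - cos (4 * x)" "cos (11 * x) = - cos (2 * x)"
    using cos_pi_minus[of "12 * x"] cos_pi_minus[of "10 * x"] cos_pi_minus[of "8 * x"]
      cos_pi_minus[of "6 * x"] cos_pi_minus[of "4 * x"] cos_pi_minus[of "2 * x"]
    by (simp_all flip: x)
  have A: "4 * A = sin x + sin (3 * x) + sin (4 * x)"
    unfolding A_def sin_times_sin_times_sin by (simp add: sin_refl)
  have B: "4 * B = sin (2 * x) - sin (5 * x) + sin (6 * x)"
    unfolding B_def sin_times_sin_times_sin by (simp add: sin_refl)
  define P where "P = cos (2 * x) + cos (6 * x) + cos (8 * x)"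
  define Q where "Q = cos (4 * x) + cos (10 * x) + cos (12 * x)"
  have "(4 * A)\<^sup>2 = 3/2 + P/2 - Q"
    unfolding A P_def Q_def power2_eq_square
    by (simp add: distrib_left distrib_right left_diff_distrib right_diff_distrib
        sin_times_sin cos_refl add_divide_distrib diff_divide_distrib)
  moreover have "(4 * B)\<^sup>2 = 3/2 + Q/2 - P"
    unfolding B P_def Q_def power2_eq_square
    by (simp add: distrib_left distrib_right left_diff_distrib right_diff_distrib
        sin_times_sin cos_refl add_divide_distrib diff_divide_distrib)
  moreover have "(4 * A) * (4 * B) = (P - Q) / 2"
    unfolding A B P_def Q_def
    by (simp add: distrib_left distrib_right left_diff_distrib right_diff_distrib
        sin_times_sin cos_refl add_divide_distrib diff_divide_distrib)
  ultimately show ?thesis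
    by (simp add: power_mult_distrib)
qed

theorem theorem4p7:
  shows "(sin (6 * pi / 13) * sin (2 * pi / 13) * sin (5 * pi / 13)) /
           (sin (4 * pi / 13) * sin (3 * pi / 13) * sin (pi / 13))
       - (sin (4 * pi / 13) * sin (3 * pi / 13) * sin (pi / 13)) /
           (sin (6 * pi / 13) * sin (2 * pi / 13) * sin (5 * pi / 13)) = (3::real)"
    (is "?A / ?B - ?B / ?A = 3")
proof -
  have quotients: "a / b - b / a = 3" if "a > 0" "b > 0" "a\<^sup>2 - b\<^sup>2 = 3 * (a * b)" for a b :: real
    using that by (simp add: diff_frac_eq power2_eq_square mult.commute)
  show ?thesis
  proof (rule quotients)
    show "?A > 0" "?B > 0"
      \<comment> \<open>All angles lie strictly between 0 and \<open>pi\<close>.\<close>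
      by (intro mult_pos_pos sin_gt_zero; simp)+
    show "?A\<^sup>2 - ?B\<^sup>2 = 3 * (?A * ?B)"
      using sin_pi_thirteenths_products[of "pi / 13"] by simp
  qed
qed

end
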